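(* The Gaussian and mean curvatures of an admissible pseudo-isotropic helicoidal surface of i-type in $\mathbb{I}^3_{\mathrm{p}}$ are respectively $$K=\frac{c^2}{\phi^2f^4}-\frac{z'}{f\,f'^4}(f''z'-f'z'')\qquad\text{and}\qquad H=\varepsilon\,\frac{f'^2z'-f(f''z'-f'z'')}{2f\,f'^3},$$ where $\varepsilon=+1$ if the generating curve is spacelike, $\alpha(u)=(f(u),0,z(u))$, in which case the surface is $$Zh_2(u,t)=(f(u)\cosh(t\phi),\ f(u)\sinh(t\phi),\ z(u)+ct),$$ and $\varepsilon=-1$ if the generating curve is timelike, $\alpha(u)=(0,f(u),z(u))$, in which case the surface is $$Wh_2(u,t)=(f(u)\sinh(t\phi),\ f(u)\cosh(t\phi),\ z(u)+ct).$$
   Context: Here $c,\phi\in\mathbb{R}$ are constants, generating curves are $C^2$, and primes denote $d/du$. The pseudo-isotropic space $\mathbb{I}^3_{\mathrm{p}}$ is $\mathbb{R}^3$ with the degenerate metric $\langle u,v\rangle_{pz}=u^1v^1-u^2v^2$. For a $C^2$ parameterized surface $\mathbf{x}(u^1,u^2)=(x^1,x^2,x^3)$ write $\mathbf{x}_i=\partial\mathbf{x}/\partial u^i$, $\mathbf{x}_{ij}=\partial^2\mathbf{x}/\partial u^i\partial u^j$, $x^i_k=\partial x^i/\partial u^k$, $X_{ij}=x^i_1x^j_2-x^j_1x^i_2$. The surface is admissible if $X_{12}\neq0$ (equivalently, the induced metric has rank 2). Put $g_{ij}=\langle\mathbf{x}_i,\mathbf{x}_j\rangle_{pz}$, $N_h=\left(\frac{X_{23}}{X_{12}},\frac{X_{13}}{X_{12}},1\right)$,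 $h_{ij}=\langle N_h,\mathbf{x}_{ij}\rangle_1$, where $\langle u,v\rangle_1=u^1v^1-u^2v^2+u^3v^3$. The Gaussian and mean curvatures are $$K=\frac{h_{11}h_{22}-h_{12}^2}{g_{11}g_{22}-g_{12}^2},\qquad H=\frac12\,\frac{g_{11}h_{22}-2g_{12}h_{12}+g_{22}h_{11}}{g_{11}g_{22}-g_{12}^2};$$ equivalently $K=\det L$, $H=\frac12\mathrm{tr}\,L$ with $L=-D\xi^{\mathrm p}$, $\xi^{\mathrm p}=\left(A,B,\frac12(1-A^2+B^2)\right)$, $A=X_{23}/X_{12}$, $B=X_{13}/X_{12}$. For the surfaces in the claim the coordinates are $(u^1,u^2)=(u,t)$. *)

theory Defs
  imports "HOL-Analysis.Analysis"
begin

text \<open>The ambient space is \<open>real ^ 3\<close> with the degenerate metric \<open>ip_pz\<close>. A parameterized surface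
  is a map \<open>x u1 u2\<close>; parameter indices live in the type \<open>2\<close> and coordinate indices in the type \<open>3\<close>.\<close>

definition ip_pz :: "real ^ 3 \<Rightarrow> real ^ 3 \<Rightarrow> real" where
  "ip_pz v w = v $ 1 * w $ 1 - v $ 2 * w $ 2"

definition ip_1 :: "real ^ 3 \<Rightarrow> real ^ 3 \<Rightarrow> real" where
  "ip_1 v w = v $ 1 * w $ 1 - v $ 2 * w $ 2 + v $ 3 * w $ 3"

definition pd :: "2 \<Rightarrow> (real \<Rightarrow> real \<Rightarrow> real ^ 3) \<Rightarrow> real \<Rightarrow> real \<Rightarrow> real ^ 3" where
  "pd k x u t = (if k = 1 then vector_derivative (\<lambda>s. x s t) (at u)
                 else vector_derivative (\<lambda>s. x u s) (at t))"

definition X_minor :: "(real \<Rightarrow> real \<Rightarrow> real ^ 3) \<Rightarrow> 3 \<Rightarrow> 3 \<Rightarrow> real \<Rightarrow> real \<Rightarrow> real" where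
  "X_minor x i j u t = pd 1 x u t $ i * pd 2 x u t $ j - pd 1 x u t $ j * pd 2 x u t $ i"

definition admissible_on :: "(real \<times> real) set \<Rightarrow> (real \<Rightarrow> real \<Rightarrow> real ^ 3) \<Rightarrow> bool" where
  "admissible_on D x \<longleftrightarrow> (\<forall>(u, t) \<in> D. X_minor x 1 2 u t \<noteq> 0)"

definition fff :: "(real \<Rightarrow> real \<Rightarrow> real ^ 3) \<Rightarrow> 2 \<Rightarrow> 2 \<Rightarrow> real \<Rightarrow> real \<Rightarrow> real" where
  "fff x i j u t = ip_pz (pd i x u t) (pd j x u t)"

definition N_h :: "(real \<Rightarrow> real \<Rightarrow> real ^ 3) \<Rightarrow> real \<Rightarrow> real \<Rightarrow> real ^ 3" where
  "N_h x u t = vector [X_minor x 2 3 u t / X_minor x 1 2 u t,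
                       X_minor x 1 3 u t / X_minor x 1 2 u t, 1]"

definition sff :: "(real \<Rightarrow> real \<Rightarrow> real ^ 3) \<Rightarrow> 2 \<Rightarrow> 2 \<Rightarrow> real \<Rightarrow> real \<Rightarrow> real" where
  "sff x i j u t = ip_1 (N_h x u t) (pd i (pd j x) u t)"

definition gauss_curv :: "(real \<Rightarrow> real \<Rightarrow> real ^ 3) \<Rightarrow> real \<Rightarrow> real \<Rightarrow> real" where
  "gauss_curv x u t =
     (sff x 1 1 u t * sff x 2 2 u t - (sff x 1 2 u t)\<^sup>2)
     / (fff x 1 1 u t * fff x 2 2 u t - (fff x 1 2 u t)\<^sup>2)"

definition mean_curv :: "(real \<Rightarrow> real \<Rightarrow> real ^ 3) \<Rightarrow> real \<Rightarrow> real \<Rightarrow> real" where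
  "mean_curv x u t =
     1 / 2 * ((fff x 1 1 u t * sff x 2 2 u t - 2 * fff x 1 2 u t * sff x 1 2 u t
               + fff x 2 2 u t * sff x 1 1 u t)
              / (fff x 1 1 u t * fff x 2 2 u t - (fff x 1 2 u t)\<^sup>2))"

definition C2_curve_on :: "real set \<Rightarrow> (real \<Rightarrow> real ^ 3) \<Rightarrow> bool" where
  "C2_curve_on I \<alpha> \<longleftrightarrow> \<alpha> C1_differentiable_on I
     \<and> (\<lambda>u. vector_derivative \<alpha> (at u)) C1_differentiable_on I"

definition spacelike_on :: "real set \<Rightarrow> (real \<Rightarrow> real ^ 3) \<Rightarrow> bool" where
  "spacelike_on I \<alpha> \<longleftrightarrow>
     (\<forall>u\<in>I. ip_pz (vector_derivative \<alpha> (at u)) (vector_derivative \<alpha> (at u)) > 0)"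

definition timelike_on :: "real set \<Rightarrow> (real \<Rightarrow> real ^ 3) \<Rightarrow> bool" where
  "timelike_on I \<alpha> \<longleftrightarrow>
     (\<forall>u\<in>I. ip_pz (vector_derivative \<alpha> (at u)) (vector_derivative \<alpha> (at u)) < 0)"

text \<open>The helicoidal surfaces of i-type with generating curves \<open>(f, 0, z)\<close> and \<open>(0, f, z)\<close>.\<close>

definition Zh2 :: "real \<Rightarrow> real \<Rightarrow> (real \<Rightarrow> real) \<Rightarrow> (real \<Rightarrow> real) \<Rightarrow> real \<Rightarrow> real \<Rightarrow> real ^ 3" where
  "Zh2 c \<phi> f z u t = vector [f u * cosh (t * \<phi>), f u * sinh (t * \<phi>), z u + c * t]"

definition Wh2 :: "real \<Rightarrow> real \<Rightarrow> (real \<Rightarrow> real) \<Rightarrow> (real \<Rightarrow> real) \<Rightarrow> real \<Rightarrow> real \<Rightarrow> real ^ 3" where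
  "Wh2 c \<phi> f z u t = vector [f u * sinh (t * \<phi>), f u * cosh (t * \<phi>), z u + c * t]"

end

theory Submission
  imports Defs
begin

text \<open>Both families are instances of one surface
  \<open>(u, t) \<mapsto> (f u * p t, f u * q t, z u + c * t)\<close>, where \<open>(p, q)\<close> is the orbit of a point of the
  Lorentzian unit hyperbola \<open>p\<^sup>2 - q\<^sup>2 = \<epsilon>\<close> under hyperbolic rotation, so that \<open>p' = \<phi> q\<close> and
  \<open>q' = \<phi> p\<close>: the spacelike case is \<open>(cosh, sinh)\<close> with \<open>\<epsilon> = 1\<close>, the timelike case is
  \<open>(sinh, cosh)\<close> with \<open>\<epsilon> = - 1\<close>. The curvatures follow from these three
  relations alone.
  The coordinate lines are orthogonal for the degenerate metric, with \<open>g\<^sub>1\<^sub>1 = \<epsilon> f'\<^sup>2\<close> and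
  \<open>g\<^sub>2\<^sub>2 = - \<epsilon> f\<^sup>2 \<phi>\<^sup>2\<close>. The second derivatives have horizontal parts that are multiples
  of \<open>(p, q)\<close> or \<open>(q, p)\<close>; when they are paired with \<open>N_h\<close>, \<open>p\<^sup>2 - q\<^sup>2 = \<epsilon>\<close> cancels against the factor \<open>\<epsilon>\<close> in
  \<open>X\<^sub>1\<^sub>2 = \<epsilon> \<phi> f f'\<close>. Hence
  \<open>h\<^sub>1\<^sub>1 = z'' - f'' z' / f'\<close>, \<open>h\<^sub>1\<^sub>2 = - c f' / f\<close> and \<open>h\<^sub>2\<^sub>2 = - \<phi>\<^sup>2 f z' / f'\<close> do not involve
  \<open>\<epsilon>\<close>. The sign is then squared away in the determinant of the metric, which gives a common
  formula for \<open>K\<close>, and survives once in \<open>H\<close>, which is linear in the metric coefficients.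
  Admissibility says exactly that \<open>\<phi>\<close>, \<open>f\<close> and \<open>f'\<close> do not vanish, so that the divisions make
  sense.\<close>

text \<open>The helicoidal motion carries \<open>(f u, 0, z u)\<close> or \<open>(0, f u, z u)\<close> along a branch of a
  hyperbola while translating it by \<open>c * t\<close>. Keeping the unit branch \<open>(p, q)\<close> as a parameter lets
  one computation serve both causal types.\<close>

definition hyperbolic_helicoid ::
    "(real \<Rightarrow> real) \<Rightarrow> (real \<Rightarrow> real) \<Rightarrow> real \<Rightarrow> (real \<Rightarrow> real) \<Rightarrow> (real \<Rightarrow> real) \<Rightarrow> real \<Rightarrow> real \<Rightarrow> real ^ 3"
  where "hyperbolic_helicoid p q c f z u t = vector [f u * p t, f u * q t, z u + c * t]"

lemma has_vector_derivative_vector_3: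
  fixes a b c :: "real \<Rightarrow> real"
  assumes "(a has_real_derivative a') F" and "(b has_real_derivative b') F"
    and "(c has_real_derivative c') F" and "F = at x within S"
  shows "((\<lambda>s. vector [a s, b s, c s] :: real ^ 3) has_vector_derivative vector [a', b', c']) F"
proof -
  have vector_3_axis: "(vector [r, s, w] :: real ^ 3) = r *\<^sub>R axis 1 1 + s *\<^sub>R axis 2 1 + w *\<^sub>R axis 3 1"
    for r s w :: real
    by (simp add: vec_eq_iff forall_3 axis_def)
  show ?thesis
    using assms unfolding vector_3_axis
    by (auto intro!: derivative_eq_intros simp: has_real_derivative_iff_has_vector_derivative)
qed

lemma vector_derivative_vector_3:
  fixes a b c :: "real \<Rightarrow> real"
  assumes "(a has_real_derivative a') (at x)" and "(b has_real_derivative b') (at x)"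
    and "(c has_real_derivative c') (at x)"
  shows "vector_derivative (\<lambda>s. vector [a s, b s, c s] :: real ^ 3) (at x) = vector [a', b', c']"
  by (rule vector_derivative_at, rule has_vector_derivative_vector_3[OF assms refl])

lemma vector_derivative_cong_open:
  assumes "open S" and "x \<in> S" and "\<And>y. y \<in> S \<Longrightarrow> g y = h y"
  shows "vector_derivative g (at x) = vector_derivative h (at x)"
  using assms by (intro vector_derivative_cong_eq) (auto simp: eventually_nhds)

lemma C1_differentiable_on_component:
  fixes \<alpha> :: "real \<Rightarrow> real ^ 'n"
  assumes "\<alpha> C1_differentiable_on I" and "u \<in> I"
  shows "((\<lambda>v. \<alpha> v $ i) has_real_derivative vector_derivative \<alpha> (at u) $ i) (at u)"
proof -
  have "\<alpha> differentiable (at u)"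
    using assms by (auto simp: C1_differentiable_on_eq)
  then have "(\<alpha> has_vector_derivative vector_derivative \<alpha> (at u)) (at u)"
    by (simp add: vector_derivative_works)
  then show ?thesis
    unfolding has_real_derivative_iff_has_vector_derivative
    by (rule bounded_linear.has_vector_derivative[OF bounded_linear_vec_nth])
qed

text \<open>On the open set \<open>I\<close> the derivative of a coordinate agrees with the coordinate of the
  derivative at all points near \<open>u\<close>, not only at \<open>u\<close> itself; hence differentiability of the
  velocity passes to second derivatives of the coordinate functions.\<close>

lemma C2_curve_on_component:
  assumes "open I" and "C2_curve_on I \<alpha>" and "u \<in> I"
  shows "((\<lambda>v. \<alpha> v $ i) has_real_derivative deriv (\<lambda>v. \<alpha> v $ i) u) (at u)"
    and "(deriv (\<lambda>v. \<alpha> v $ i) has_real_derivative deriv (deriv (\<lambda>v. \<alpha> v $ i)) u) (at u)"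
proof -
  have \<alpha>: "\<alpha> C1_differentiable_on I"
    and \<alpha>': "(\<lambda>u. vector_derivative \<alpha> (at u)) C1_differentiable_on I"
    using assms(2) by (auto simp: C2_curve_on_def)
  have deriv_eq: "deriv (\<lambda>v. \<alpha> v $ i) v = vector_derivative \<alpha> (at v) $ i" if "v \<in> I" for v
    using C1_differentiable_on_component[OF \<alpha> that] by (rule DERIV_imp_deriv)
  show "((\<lambda>v. \<alpha> v $ i) has_real_derivative deriv (\<lambda>v. \<alpha> v $ i) u) (at u)"
    using C1_differentiable_on_component[OF \<alpha> \<open>u \<in> I\<close>] by (simp add: deriv_eq \<open>u \<in> I\<close>)
  have "(deriv (\<lambda>v. \<alpha> v $ i) has_real_derivative
      vector_derivative (\<lambda>u. vector_derivative \<alpha> (at u)) (at u) $ i) (at u)"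
    using C1_differentiable_on_component[OF \<alpha>' \<open>u \<in> I\<close>] \<open>open I\<close> \<open>u \<in> I\<close>
    by (rule has_field_derivative_transform_within_open) (simp add: deriv_eq)
  then show "(deriv (\<lambda>v. \<alpha> v $ i) has_real_derivative deriv (deriv (\<lambda>v. \<alpha> v $ i)) u) (at u)"
    by (simp add: DERIV_imp_deriv)
qed

text \<open>The hypotheses on \<open>(p, q)\<close> replace the hyperbolic functions. The first derivatives of
  \<open>f\<close> and \<open>z\<close> are assumed throughout \<open>I\<close>, whereas the second ones are assumed at \<open>u\<close> only:
  \<open>x\<^sub>1\<^sub>1\<close> arises by differentiating \<open>x\<^sub>1\<close> at \<open>u\<close>, for which \<open>x\<^sub>1\<close> must be known near \<open>u\<close>.\<close>

lemma curvatures_hyperbolic_helicoid: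
  fixes c \<phi> \<epsilon> :: real and f z p q :: "real \<Rightarrow> real"
  assumes "open I" and "u \<in> I"
    and f: "\<And>v. v \<in> I \<Longrightarrow> (f has_real_derivative deriv f v) (at v)"
    and f': "(deriv f has_real_derivative deriv (deriv f) u) (at u)"
    and z: "\<And>v. v \<in> I \<Longrightarrow> (z has_real_derivative deriv z v) (at v)"
    and z': "(deriv z has_real_derivative deriv (deriv z) u) (at u)"
    and p: "\<And>t. (p has_real_derivative \<phi> * q t) (at t)"
    and q: "\<And>t. (q has_real_derivative \<phi> * p t) (at t)"
    and pq: "\<And>t. (p t)\<^sup>2 - (q t)\<^sup>2 = \<epsilon>"
    and \<epsilon>: "\<epsilon>\<^sup>2 = 1"
    and adm: "admissible_on (I \<times> UNIV) (hyperbolic_helicoid p q c f z)"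
  shows "gauss_curv (hyperbolic_helicoid p q c f z) u t =
           c\<^sup>2 / (\<phi>\<^sup>2 * f u ^ 4)
           - deriv z u / (f u * deriv f u ^ 4)
             * (deriv (deriv f) u * deriv z u - deriv f u * deriv (deriv z) u)" (is ?K)
    and "mean_curv (hyperbolic_helicoid p q c f z) u t =
           \<epsilon> * (((deriv f u)\<^sup>2 * deriv z u
                 - f u * (deriv (deriv f) u * deriv z u - deriv f u * deriv (deriv z) u))
                / (2 * f u * deriv f u ^ 3))" (is ?H)
proof -
  let ?x = "hyperbolic_helicoid p q c f z"
  let ?fu = "f u" and ?f1 = "deriv f u" and ?f2 = "deriv (deriv f) u"
    and ?z1 = "deriv z u" and ?z2 = "deriv (deriv z) u"
  have x_1: "pd 1 ?x v s = vector [deriv f v * p s, deriv f v * q s, deriv z v]" if "v \<in> I" for v s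
    unfolding pd_def hyperbolic_helicoid_def
    by (simp, rule vector_derivative_vector_3) (auto intro!: derivative_eq_intros f z that)
  have x_2: "pd 2 ?x v s = vector [\<phi> * f v * q s, \<phi> * f v * p s, c]" for v s
    unfolding pd_def hyperbolic_helicoid_def
    by (simp, rule vector_derivative_vector_3) (auto intro!: derivative_eq_intros p q)
  have x_11: "pd 1 (pd 1 ?x) u t = vector [?f2 * p t, ?f2 * q t, ?z2]"
  proof -
    have "pd 1 (pd 1 ?x) u t = vector_derivative
        (\<lambda>v. vector [deriv f v * p t, deriv f v * q t, deriv z v] :: real ^ 3) (at u)"
      using vector_derivative_cong_open[OF \<open>open I\<close> \<open>u \<in> I\<close> x_1] by (simp add: pd_def[of 1 "pd 1 ?x"])
    also have "\<dots> = vector [?f2 * p t, ?f2 * q t, ?z2]"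
      by (rule vector_derivative_vector_3) (auto intro!: derivative_eq_intros f' z')
    finally show ?thesis .
  qed
  have x_12: "pd 1 (pd 2 ?x) u t = vector [\<phi> * ?f1 * q t, \<phi> * ?f1 * p t, 0]"
    unfolding pd_def[of 1 "pd 2 ?x"] x_2
    by (simp, rule vector_derivative_vector_3) (auto intro!: derivative_eq_intros f \<open>u \<in> I\<close>)
  have x_22: "pd 2 (pd 2 ?x) u t = vector [\<phi>\<^sup>2 * ?fu * p t, \<phi>\<^sup>2 * ?fu * q t, 0]"
    unfolding pd_def[of 2 "pd 2 ?x"] x_2
    by (simp, rule vector_derivative_vector_3)
      (auto intro!: derivative_eq_intros p q simp: power2_eq_square)
  note x_1 = x_1[OF \<open>u \<in> I\<close>]
  have "\<epsilon> \<noteq> 0"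
    using \<epsilon> by auto
  have X_12: "X_minor ?x 1 2 u t = \<epsilon> * \<phi> * ?fu * ?f1"
    unfolding X_minor_def x_1 x_2 pq[of t, symmetric] by (simp add: power2_eq_square algebra_simps)
  have "X_minor ?x 1 2 u t \<noteq> 0"
    using adm \<open>u \<in> I\<close> by (auto simp: admissible_on_def)
  then have nonzero: "\<phi> \<noteq> 0" "?fu \<noteq> 0" "?f1 \<noteq> 0"
    unfolding X_12 by auto
  define A B where "A = N_h ?x u t $ 1" and "B = N_h ?x u t $ 2"
  have A: "A = (c * ?f1 * q t - \<phi> * ?fu * ?z1 * p t) / (\<epsilon> * \<phi> * ?fu * ?f1)"
    and B: "B = (c * ?f1 * p t - \<phi> * ?fu * ?z1 * q t) / (\<epsilon> * \<phi> * ?fu * ?f1)"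
    unfolding A_def B_def N_h_def X_12 by (simp_all add: X_minor_def x_1 x_2 algebra_simps)
  have N_3: "N_h ?x u t $ 3 = 1"
    by (simp add: N_h_def)
  \<comment> \<open>The vectors \<open>x\<^sub>1\<^sub>1\<close> and \<open>x\<^sub>2\<^sub>2\<close> are horizontally parallel to \<open>(p, q)\<close>, and \<open>x\<^sub>1\<^sub>2\<close> is
    parallel to \<open>(q, p)\<close>; these two Lorentzian products therefore determine the whole second
    fundamental form. In the first one the terms with \<open>c\<close> cancel, in the second one those with
    \<open>z'\<close>.\<close>
  have Ap_Bq: "A * p t - B * q t = - (?z1 / ?f1)"
  proof -
    have "A * p t - B * q t = - (\<phi> * ?fu * ?z1) * ((p t)\<^sup>2 - (q t)\<^sup>2) / (\<epsilon> * \<phi> * ?fu * ?f1)"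
      unfolding A B by (simp add: diff_divide_distrib[symmetric] power2_eq_square algebra_simps)
    then show ?thesis
      using nonzero \<open>\<epsilon> \<noteq> 0\<close> by (simp add: pq)
  qed
  have Aq_Bp: "A * q t - B * p t = - (c / (\<phi> * ?fu))"
  proof -
    have "A * q t - B * p t = - (c * ?f1) * ((p t)\<^sup>2 - (q t)\<^sup>2) / (\<epsilon> * \<phi> * ?fu * ?f1)"
      unfolding A B by (simp add: diff_divide_distrib[symmetric] power2_eq_square algebra_simps)
    then show ?thesis
      using nonzero \<open>\<epsilon> \<noteq> 0\<close> by (simp add: pq)
  qed
  have "sff ?x 1 1 u t = ?f2 * (A * p t - B * q t) + ?z2"
    unfolding sff_def ip_1_def x_11 N_3 A_def[symmetric] B_def[symmetric] by (simp add: algebra_simps)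
  then have h_11: "sff ?x 1 1 u t = ?z2 - ?f2 * ?z1 / ?f1"
    by (simp add: Ap_Bq)
  have "sff ?x 1 2 u t = \<phi> * ?f1 * (A * q t - B * p t)"
    unfolding sff_def ip_1_def x_12 N_3 A_def[symmetric] B_def[symmetric] by (simp add: algebra_simps)
  then have h_12: "sff ?x 1 2 u t = - (c * ?f1 / ?fu)"
    using nonzero by (simp add: Aq_Bp)
  have "sff ?x 2 2 u t = \<phi>\<^sup>2 * ?fu * (A * p t - B * q t)"
    unfolding sff_def ip_1_def x_22 N_3 A_def[symmetric] B_def[symmetric] by (simp add: algebra_simps)
  then have h_22: "sff ?x 2 2 u t = - (\<phi>\<^sup>2 * ?fu * ?z1 / ?f1)"
    by (simp add: Ap_Bq)
  have g_11: "fff ?x 1 1 u t = \<epsilon> * ?f1\<^sup>2"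
    unfolding fff_def ip_pz_def x_1 pq[of t, symmetric] by (simp add: power2_eq_square algebra_simps)
  have g_12: "fff ?x 1 2 u t = 0"
    unfolding fff_def ip_pz_def x_1 x_2 by simp
  have g_22: "fff ?x 2 2 u t = - \<epsilon> * \<phi>\<^sup>2 * ?fu\<^sup>2"
    unfolding fff_def ip_pz_def x_2 pq[of t, symmetric] by (simp add: power2_eq_square algebra_simps)
  have det_g: "fff ?x 1 1 u t * fff ?x 2 2 u t - (fff ?x 1 2 u t)\<^sup>2 = - (\<phi>\<^sup>2 * ?fu\<^sup>2 * ?f1\<^sup>2)"
    using \<epsilon> unfolding g_11 g_12 g_22 by (simp add: power2_eq_square)
  show ?K
    unfolding gauss_curv_def det_g h_11 h_12 h_22 using nonzero
    by (simp add: field_simps power2_eq_square power4_eq_xxxx)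
  show ?H
    unfolding mean_curv_def det_g unfolding g_11 g_12 g_22 h_11 h_12 h_22 using nonzero
    by (simp add: field_simps power2_eq_square power3_eq_cube)
qed

theorem proposition6p2:
  fixes c \<phi> \<epsilon> :: real and f z :: "real \<Rightarrow> real" and I :: "real set"
    and \<alpha> :: "real \<Rightarrow> real ^ 3" and x :: "real \<Rightarrow> real \<Rightarrow> real ^ 3" and u t :: real
  assumes "open I" and "is_interval I"
    and "C2_curve_on I \<alpha>"
    and "(\<epsilon> = 1 \<and> spacelike_on I \<alpha> \<and> \<alpha> = (\<lambda>v. vector [f v, 0, z v]) \<and> x = Zh2 c \<phi> f z) \<or>
         (\<epsilon> = - 1 \<and> timelike_on I \<alpha> \<and> \<alpha> = (\<lambda>v. vector [0, f v, z v]) \<and> x = Wh2 c \<phi> f z)"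
    and "admissible_on (I \<times> UNIV) x"
    and "u \<in> I"
  shows "gauss_curv x u t =
           c\<^sup>2 / (\<phi>\<^sup>2 * f u ^ 4)
           - deriv z u / (f u * deriv f u ^ 4)
             * (deriv (deriv f) u * deriv z u - deriv f u * deriv (deriv z) u)
       \<and> mean_curv x u t =
           \<epsilon> * (((deriv f u)\<^sup>2 * deriv z u
                 - f u * (deriv (deriv f) u * deriv z u - deriv f u * deriv (deriv z) u))
                / (2 * f u * deriv f u ^ 3))"
proof -
  have "\<exists>i. (\<lambda>v. \<alpha> v $ i) = f"
    using assms(4) by (auto intro: exI[of _ 1] exI[of _ 2])
  then obtain i where f: "(\<lambda>v. \<alpha> v $ i) = f"
    by blast
  have z: "(\<lambda>v. \<alpha> v $ 3) = z"
    using assms(4) by auto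
  note component = C2_curve_on_component[OF \<open>open I\<close> \<open>C2_curve_on I \<alpha>\<close>]
  note f_derivs = component[where i = i, unfolded f]
  note z_derivs = component[where i = 3, unfolded z]
  obtain p q where x: "x = hyperbolic_helicoid p q c f z"
    and pq: "\<And>s. (p has_real_derivative \<phi> * q s) (at s)"
      "\<And>s. (q has_real_derivative \<phi> * p s) (at s)" "\<And>s. (p s)\<^sup>2 - (q s)\<^sup>2 = \<epsilon>"
    and \<epsilon>: "\<epsilon>\<^sup>2 = 1"
    using assms(4)
  proof (elim disjE conjE)
    assume "\<epsilon> = 1" and "x = Zh2 c \<phi> f z"
    show ?thesis
    proof (rule that)
      show "x = hyperbolic_helicoid (\<lambda>s. cosh (s * \<phi>)) (\<lambda>s. sinh (s * \<phi>)) c f z"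
        using \<open>x = _\<close> by (simp add: fun_eq_iff Zh2_def hyperbolic_helicoid_def)
    qed (auto intro!: derivative_eq_intros simp: \<open>\<epsilon> = 1\<close> cosh_square_eq)
  next
    assume "\<epsilon> = - 1" and "x = Wh2 c \<phi> f z"
    show ?thesis
    proof (rule that)
      show "x = hyperbolic_helicoid (\<lambda>s. sinh (s * \<phi>)) (\<lambda>s. cosh (s * \<phi>)) c f z"
        using \<open>x = _\<close> by (simp add: fun_eq_iff Wh2_def hyperbolic_helicoid_def)
    qed (auto intro!: derivative_eq_intros simp: \<open>\<epsilon> = - 1\<close> cosh_square_eq)
  qed
  show ?thesis
    using curvatures_hyperbolic_helicoid[OF \<open>open I\<close> \<open>u \<in> I\<close> f_derivs(1) f_derivs(2)[OF \<open>u \<in> I\<close>]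
        z_derivs(1) z_derivs(2)[OF \<open>u \<in> I\<close>] pq \<epsilon> assms(5)[unfolded x]]
    unfolding x by blast
qed

end
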